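(* The capacity $\mathsf{C}_{\mathrm B}(\mathbf{h},\boldsymbol{\alpha},\sigma)$ can be equivalently written as $$\mathsf{C}_{\mathrm B}(\mathbf{h},\boldsymbol{\alpha},\sigma)=\sup_{\mathscr{P}_S} I(S;S+Z),$$ where the supremum is over all probability laws $\mathscr{P}_S$ of a random variable $S$ (independent of $Z$) with $\mathsf{supp}\,S\subseteq[0,1]$ satisfying $$\mathbb{E}\big[(S-\mathsf{H}_{[k]})_+\big]\le(1-\mathsf{H}_{[k]})\bar\alpha_k\quad\text{for all }k\in\{0,1,\dots,n-1\}.$$
   Context: Let $n\ge 2$ be an integer, $\mathbf{h}=(h_1,\dots,h_n)^{\mathsf T}$ with $h_k>0$ and $\sum_{k=1}^n h_k=1$, and $\boldsymbol{\alpha}=(\alpha_1,\dots,\alpha_n)^{\mathsf T}$ with $1\ge\alpha_1>\alpha_2>\cdots>\alpha_n>0$ and $\alpha_n\le \tfrac12$. Put $\mathsf{H}_{[0]}=0$, $\mathsf{H}_{[k]}=\sum_{i=1}^k h_i$ and $\bar\alpha_k=\frac{\sum_{i=k+1}^n h_i\alpha_i}{1-\mathsf{H}_{[k]}}$ for $0\le k\le n-1$, and $(a)_+=\max\{a,0\}$. Channel: $Y=\mathbf{h}^{\mathsf T}\mathbf{X}+Z$ with $Z\sim\mathcal{N}(0,\sigma^2)$, $\sigma>0$, independent of $\mathbf{X}=(X_1,\dots,X_n)^{\mathsf T}$. The BC-OIC capacity is $\mathsf{C}_{\mathrm B}(\mathbf{h},\boldsymbol{\alpha},\sigma)=\sup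 I(\mathbf{X};Y)$, the supremum being over all laws of $\mathbf{X}$ with $0\le X_k\le1$ (almost surely) and $\mathbb{E}[X_k]\le\alpha_k$ for all $k\in\{1,\dots,n\}$. $I(\cdot;\cdot)$ denotes mutual information. *)

theory Defs
  imports "HOL-Probability.Probability"
begin

definition Hsum :: "(nat \<Rightarrow> real) \<Rightarrow> nat \<Rightarrow> real" where
  "Hsum h k = (\<Sum>i = 1..k. h i)"

definition alpha_bar :: "nat \<Rightarrow> (nat \<Rightarrow> real) \<Rightarrow> (nat \<Rightarrow> real) \<Rightarrow> nat \<Rightarrow> real" where
  "alpha_bar n h \<alpha> k = (\<Sum>i = k+1..n. h i * \<alpha> i) / (1 - Hsum h k)"

definition gaussian_noise :: "real \<Rightarrow> real measure" where
  "gaussian_noise \<sigma> = density lborel (\<lambda>z. ennreal (normal_density 0 \<sigma> z))"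

(* I(W; f(W) + Z) in units of log b, for W distributed according to the probability law \<mu> and
   Z ~ N(0, \<sigma>^2) independent of W: the pair (W, Z) is realised as the two coordinates on the
   product space.

   The library's mutual information is a Bochner integral of a log-density, so it would silently
   be 0 if that density did not exist or its logarithm were not integrable.  Neither happens when
   f(W) is a.s. bounded, as in all uses below: the density of the joint law of (W, Y), Y = f(W) + Z,
   with respect to the product of its marginals is \<phi>(y - f w) / p(y), where \<phi> is the density of Z
   and p(y) = E[\<phi>(y - f W)], and its logarithm is a.s. bounded by a quadratic polynomial in y. *)
definition gaussian_channel_mi ::
    "real \<Rightarrow> real \<Rightarrow> 'a measure \<Rightarrow> ('a \<Rightarrow> real) \<Rightarrow> real" where
  "gaussian_channel_mi b \<sigma> \<mu> f =
     prob_space.mutual_information (\<mu> \<Otimes>\<^sub>M gaussian_noise \<sigma>) b \<mu> borel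
       (\<lambda>(w, z). w) (\<lambda>(w, z). f w + z)"

(* Random vectors (X_1, ..., X_n) take values in the product space PiM {1..n} (\<lambda>_. borel). *)
definition admissible_input_laws :: "nat \<Rightarrow> (nat \<Rightarrow> real) \<Rightarrow> (nat \<Rightarrow> real) measure set" where
  "admissible_input_laws n \<alpha> =
     {\<mu>. prob_space \<mu> \<and> sets \<mu> = sets (\<Pi>\<^sub>M k\<in>{1..n}. (borel :: real measure)) \<and>
         (\<forall>k\<in>{1..n}. (AE x in \<mu>. 0 \<le> x k \<and> x k \<le> 1) \<and> (\<integral>x. x k \<partial>\<mu>) \<le> \<alpha> k)}"

definition BC_OIC_capacity ::
    "real \<Rightarrow> nat \<Rightarrow> (nat \<Rightarrow> real) \<Rightarrow> (nat \<Rightarrow> real) \<Rightarrow> real \<Rightarrow> ereal" where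
  "BC_OIC_capacity b n h \<alpha> \<sigma> =
     (SUP \<mu> \<in> admissible_input_laws n \<alpha>.
        ereal (gaussian_channel_mi b \<sigma> \<mu> (\<lambda>x. \<Sum>k = 1..n. h k * x k)))"

definition law_support :: "'a::topological_space measure \<Rightarrow> 'a set" where
  "law_support \<nu> = {x. \<forall>U. open U \<and> x \<in> U \<longrightarrow> emeasure \<nu> U > 0}"

definition admissible_sum_laws ::
    "nat \<Rightarrow> (nat \<Rightarrow> real) \<Rightarrow> (nat \<Rightarrow> real) \<Rightarrow> real measure set" where
  "admissible_sum_laws n h \<alpha> =
     {\<nu>. prob_space \<nu> \<and> sets \<nu> = sets (borel :: real measure) \<and>
         law_support \<nu> \<subseteq> {0..1} \<and>
         (\<forall>k\<in>{0..n-1}. (\<integral>s. max (s - Hsum h k) 0 \<partial>\<nu>) \<le> (1 - Hsum h k) * alpha_bar n h \<alpha> k)}"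

end

theory Submission
  imports Defs
begin

text \<open>
  The mutual information of the input with the output depends on the input only through the law of
  the weighted sum \<open>S\<close>, because the density of the joint law with respect to the product of its
  marginals is a function of the weighted sum and the output.  It remains to identify the laws of
  \<open>S\<close>.  The constraints on the expected excesses are necessary since \<open>(S - H\<^sub>k)\<^sub>+\<close> is at most the
  contribution to \<open>S\<close> of the inputs after the \<open>k\<close>-th one.  Conversely, an \<open>S\<close> satisfying them is
  split by induction on the number of inputs.  The last input, which has the smallest mean
  constraint, receives the slice of \<open>S\<close> between \<open>c\<close> and \<open>c + h\<^sub>n\<close>; the level \<open>c\<close> is either chosen by
  the intermediate value theorem such that the mean constraint is tight, or \<open>0\<close>.  The remainder
  satisfies the constraints for \<open>n - 1\<close> inputs: at levels below \<open>c\<close> the tight mean is subtracted,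
  and at levels above \<open>c\<close> the excess is that of \<open>S\<close> at a level higher by \<open>h\<^sub>n\<close>, which is bounded by
  convexity.
\<close>

section \<open>Gaussian channel: the output density and the mutual information as a function of the
  law of the sum\<close>

text \<open>The Lebesgue density of the channel output when the noiseless signal has law
  \<open>\<nu>\<close>. It is \<open>ennreal\<close>-valued so that Tonelli applies without
  integrability side conditions.\<close>

definition output_density :: "real \<Rightarrow> real measure \<Rightarrow> real \<Rightarrow> ennreal" where
  "output_density \<sigma> \<nu> y = (\<integral>\<^sup>+ s. ennreal (normal_density 0 \<sigma> (y - s)) \<partial>\<nu>)"

lemma measurable_output_density [measurable]:
  assumes "prob_space \<nu>" and [measurable_cong]: "sets \<nu> = sets borel"
  shows "output_density \<sigma> \<nu> \<in> borel_measurable borel"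
proof -
  interpret prob_space \<nu> by fact
  show ?thesis unfolding output_density_def by measurable
qed

text \<open>The Gaussian density vanishes nowhere, so its average over a probability law cannot
  vanish. Together with finiteness at every \<open>y\<close>, this makes division by the output
  density legitimate without an exceptional set.\<close>

lemma output_density_pos:
  assumes "prob_space \<nu>" and [measurable_cong]: "sets \<nu> = sets borel" and "\<sigma> > 0"
  shows "output_density \<sigma> \<nu> y > 0"
proof (rule ccontr)
  interpret prob_space \<nu> by fact
  assume "\<not> ?thesis"
  then have "AE s in \<nu>. ennreal (normal_density 0 \<sigma> (y - s)) = 0"
    unfolding output_density_def by (subst nn_integral_0_iff_AE[symmetric]) (auto simp: not_less)
  then have "AE s in \<nu>. False"
    by eventually_elim (metis ennreal_eq_0_iff normal_density_pos[OF \<open>\<sigma> > 0\<close>] not_le)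
  then show False
    by simp
qed

text \<open>The Gaussian density is bounded by its peak value, and \<open>\<nu>\<close> has total
  mass one.\<close>

lemma output_density_finite:
  assumes "prob_space \<nu>" and "\<sigma> > 0"
  shows "output_density \<sigma> \<nu> y < \<infinity>"
proof -
  interpret prob_space \<nu> by fact
  have "normal_density 0 \<sigma> x \<le> 1 / sqrt (2 * pi * \<sigma>\<^sup>2)" for x
    using \<open>\<sigma> > 0\<close> by (auto simp: normal_density_def intro!: divide_right_mono)
  then have "output_density \<sigma> \<nu> y \<le> (\<integral>\<^sup>+ s. ennreal (1 / sqrt (2 * pi * \<sigma>\<^sup>2)) \<partial>\<nu>)"
    unfolding output_density_def by (intro nn_integral_mono ennreal_leI)
  also have "\<dots> < \<infinity>"
    by (simp add: emeasure_space_1)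
  finally show ?thesis .
qed

text \<open>Iterated integration followed, for each fixed \<open>w\<close>, by the translation
  \<open>y = f w + z\<close>. A general \<open>g\<close> serves both the joint law (indicator of a
  set of pairs) and the output law (indicator depending on the second coordinate only).\<close>

lemma nn_integral_joint_law:
  fixes f :: "'a \<Rightarrow> real"
  assumes "\<sigma> > 0" and [measurable]: "f \<in> borel_measurable \<mu>"
    and g[measurable]: "g \<in> borel_measurable (\<mu> \<Otimes>\<^sub>M borel)"
  shows "(\<integral>\<^sup>+ x. g x \<partial>distr (\<mu> \<Otimes>\<^sub>M gaussian_noise \<sigma>) (\<mu> \<Otimes>\<^sub>M borel) (\<lambda>(w, z). (w, f w + z)))
    = (\<integral>\<^sup>+ w. \<integral>\<^sup>+ y. ennreal (normal_density 0 \<sigma> (y - f w)) * g (w, y) \<partial>lborel \<partial>\<mu>)"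
proof -
  interpret N: prob_space "gaussian_noise \<sigma>"
    unfolding gaussian_noise_def by (rule prob_space_normal_density[OF \<open>\<sigma> > 0\<close>])
  have [measurable_cong]: "sets (gaussian_noise \<sigma>) = sets borel"
    by (simp add: gaussian_noise_def)
  have "(\<integral>\<^sup>+ x. g x \<partial>distr (\<mu> \<Otimes>\<^sub>M gaussian_noise \<sigma>) (\<mu> \<Otimes>\<^sub>M borel) (\<lambda>(w, z). (w, f w + z)))
    = (\<integral>\<^sup>+ w. \<integral>\<^sup>+ z. g (w, f w + z) \<partial>gaussian_noise \<sigma> \<partial>\<mu>)"
    by (simp add: nn_integral_distr N.nn_integral_fst[symmetric] case_prod_beta')
  also have "\<dots> = (\<integral>\<^sup>+ w. \<integral>\<^sup>+ z. ennreal (normal_density 0 \<sigma> z) * g (w, f w + z) \<partial>lborel \<partial>\<mu>)"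
    unfolding gaussian_noise_def by (intro nn_integral_cong nn_integral_density) measurable
  also have "\<dots> = (\<integral>\<^sup>+ w. \<integral>\<^sup>+ y. ennreal (normal_density 0 \<sigma> (y - f w)) * g (w, y) \<partial>lborel \<partial>\<mu>)"
  proof (rule nn_integral_cong)
    fix w assume [simp]: "w \<in> space \<mu>"
    show "(\<integral>\<^sup>+ z. ennreal (normal_density 0 \<sigma> z) * g (w, f w + z) \<partial>lborel)
      = (\<integral>\<^sup>+ y. ennreal (normal_density 0 \<sigma> (y - f w)) * g (w, y) \<partial>lborel)"
      by (subst (2) nn_integral_real_affine[where c = 1 and t = "f w"]) simp_all
  qed
  finally show ?thesis .
qed

lemma distr_joint_law:
  fixes f :: "'a \<Rightarrow> real"
  assumes "\<sigma> > 0" and [measurable]: "f \<in> borel_measurable \<mu>"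
  shows "distr (\<mu> \<Otimes>\<^sub>M gaussian_noise \<sigma>) (\<mu> \<Otimes>\<^sub>M borel) (\<lambda>(w, z). (w, f w + z))
    = density (\<mu> \<Otimes>\<^sub>M lborel) (\<lambda>(w, y). ennreal (normal_density 0 \<sigma> (y - f w)))"
    (is "?J = ?D")
proof (rule measure_eqI)
  show "sets ?J = sets ?D"
    by (simp cong: sets_pair_measure_cong)
  fix A assume "A \<in> sets ?J"
  then have [measurable]: "A \<in> sets (\<mu> \<Otimes>\<^sub>M borel)"
    by simp
  have "emeasure ?J A = (\<integral>\<^sup>+ x. indicator A x \<partial>?J)"
    by simp
  also have "\<dots> = (\<integral>\<^sup>+ w. \<integral>\<^sup>+ y. ennreal (normal_density 0 \<sigma> (y - f w)) * indicator A (w, y) \<partial>lborel \<partial>\<mu>)"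
    using \<open>\<sigma> > 0\<close> by (intro nn_integral_joint_law) measurable
  also have "\<dots> = emeasure ?D A"
    by (simp add: emeasure_density lborel.nn_integral_fst[symmetric] case_prod_beta')
  finally show "emeasure ?J A = emeasure ?D A" .
qed

lemma distr_output_law:
  fixes f :: "'a \<Rightarrow> real"
  assumes "prob_space \<mu>" and "\<sigma> > 0" and [measurable]: "f \<in> borel_measurable \<mu>"
  shows "distr (\<mu> \<Otimes>\<^sub>M gaussian_noise \<sigma>) borel (\<lambda>(w, z). f w + z)
    = density lborel (output_density \<sigma> (distr \<mu> borel f))"
    (is "?P = ?D")
proof (rule measure_eqI)
  interpret \<mu>: prob_space \<mu> by fact
  interpret \<mu>L: pair_sigma_finite \<mu> lborel ..
  have [measurable_cong]: "sets (gaussian_noise \<sigma>) = sets borel"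
    by (simp add: gaussian_noise_def)
  have [measurable]: "output_density \<sigma> (distr \<mu> borel f) \<in> borel_measurable borel"
    by (intro measurable_output_density \<mu>.prob_space_distr) auto
  show "sets ?P = sets ?D"
    by simp
  fix B assume "B \<in> sets ?P"
  then have [measurable]: "B \<in> sets borel"
    by simp
  let ?J = "distr (\<mu> \<Otimes>\<^sub>M gaussian_noise \<sigma>) (\<mu> \<Otimes>\<^sub>M borel) (\<lambda>(w, z). (w, f w + z))"
  have "emeasure ?P B = (\<integral>\<^sup>+ y. indicator B y \<partial>?P)"
    by simp
  also have "\<dots> = (\<integral>\<^sup>+ x. indicator B (snd x) \<partial>?J)"
    by (simp add: nn_integral_distr case_prod_beta' del: nn_integral_indicator)
  also have "\<dots> = (\<integral>\<^sup>+ w. \<integral>\<^sup>+ y. ennreal (normal_density 0 \<sigma> (y - f w)) * indicator B y \<partial>lborel \<partial>\<mu>)"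
    using \<open>\<sigma> > 0\<close> by (subst nn_integral_joint_law) simp_all
  \<comment> \<open>After exchanging the integrals, the inner one is the output density, because the
    integrand sees \<open>w\<close> only through \<open>f w\<close>.\<close>
  also have "\<dots> = (\<integral>\<^sup>+ y. \<integral>\<^sup>+ w. ennreal (normal_density 0 \<sigma> (y - f w)) * indicator B y \<partial>\<mu> \<partial>lborel)"
    by (rule \<mu>L.Fubini'[symmetric]) measurable
  also have "\<dots> = (\<integral>\<^sup>+ y. output_density \<sigma> (distr \<mu> borel f) y * indicator B y \<partial>lborel)"
    by (simp add: output_density_def nn_integral_distr nn_integral_multc)
  also have "\<dots> = emeasure ?D B"
    by (simp add: emeasure_density)
  finally show "emeasure ?P B = emeasure ?D B" .
qed

text \<open>The density of the joint law of input and output with respect to the product of the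
  marginals is \<open>r (f w, y)\<close>. Transporting the divergence integral along
  \<open>(w, y) \<mapsto> (f w, y)\<close> removes the input space, so that only the law of
  \<open>f\<close> is left.\<close>

lemma gaussian_channel_mi_eq_integral:
  fixes f :: "'a \<Rightarrow> real"
  assumes "prob_space \<mu>" and f[measurable]: "f \<in> borel_measurable \<mu>" and "\<sigma> > 0" and "b > 1"
  defines "p \<equiv> output_density \<sigma> (distr \<mu> borel f)"
  defines "r \<equiv> \<lambda>(s, y). normal_density 0 \<sigma> (y - s) / enn2real (p y)"
  shows "gaussian_channel_mi b \<sigma> \<mu> f
    = (\<integral>x. r x * log b (r x) \<partial>(distr \<mu> borel f \<Otimes>\<^sub>M density lborel p))"
proof -
  interpret \<mu>: prob_space \<mu> by fact
  interpret N: prob_space "gaussian_noise \<sigma>"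
    unfolding gaussian_noise_def by (rule prob_space_normal_density[OF \<open>\<sigma> > 0\<close>])
  interpret \<mu>N: pair_prob_space \<mu> "gaussian_noise \<sigma>" ..
  have [measurable_cong]: "sets (gaussian_noise \<sigma>) = sets borel"
    by (simp add: gaussian_noise_def)
  have \<nu>: "prob_space (distr \<mu> borel f)"
    by (rule \<mu>.prob_space_distr) simp
  have [measurable]: "p \<in> borel_measurable borel"
    unfolding p_def by (intro measurable_output_density \<nu>) simp
  have p: "0 < p y" "p y < \<infinity>" for y
    unfolding p_def using \<nu> \<open>\<sigma> > 0\<close> by (auto intro!: output_density_pos output_density_finite simp del: infinity_ennreal_def)
  have r[measurable]: "r \<in> borel_measurable (borel \<Otimes>\<^sub>M borel)"
    unfolding r_def by measurable
  have out: "distr (\<mu> \<Otimes>\<^sub>M gaussian_noise \<sigma>) borel (\<lambda>(w, z). f w + z) = density lborel p"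
    unfolding p_def by (intro distr_output_law assms)
  have P: "prob_space (density lborel p)"
    unfolding out[symmetric] by (rule \<mu>N.prob_space_distr) simp
  interpret P: prob_space "density lborel p" by fact
  interpret \<mu>P: pair_prob_space \<mu> "density lborel p" ..
  define F where "F = (\<lambda>(w::'a, y::real). (f w, y))"
  have F[measurable]: "F \<in> measurable (\<mu> \<Otimes>\<^sub>M borel) (borel \<Otimes>\<^sub>M borel)"
    unfolding F_def by measurable
  have "distr (\<mu> \<Otimes>\<^sub>M gaussian_noise \<sigma>) (\<mu> \<Otimes>\<^sub>M borel) (\<lambda>(w, z). (w, f w + z))
    = density (\<mu> \<Otimes>\<^sub>M lborel) (\<lambda>(w, y). ennreal (normal_density 0 \<sigma> (y - f w)))"
    by (intro distr_joint_law assms)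
  \<comment> \<open>The factor \<open>1 * p y\<close> has the product shape required by
    \<open>pair_measure_density\<close>, with constant density 1 on \<open>\<mu>\<close>.\<close>
  also have "\<dots> = density (\<mu> \<Otimes>\<^sub>M lborel) (\<lambda>x. (case x of (w, y) \<Rightarrow> 1 * p y) * ennreal (r (F x)))"
  proof (rule density_cong)
    show "AE x in \<mu> \<Otimes>\<^sub>M lborel. (case x of (w, y) \<Rightarrow> ennreal (normal_density 0 \<sigma> (y - f w)))
      = (case x of (w, y) \<Rightarrow> 1 * p y) * ennreal (r (F x))"
    proof (intro AE_I2, safe)
      fix w y
      have "p y = ennreal (enn2real (p y))" "enn2real (p y) > 0"
        using p[of y] by (auto simp: enn2real_positive_iff)
      then obtain q where q: "p y = ennreal q" "q > 0"
        by blast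
      then have "r (F (w, y)) = normal_density 0 \<sigma> (y - f w) / q"
        by (simp add: F_def r_def)
      then show "ennreal (normal_density 0 \<sigma> (y - f w)) = 1 * p y * ennreal (r (F (w, y)))"
        using q by (simp add: ennreal_mult''[symmetric])
    qed
  qed (simp_all add: case_prod_beta')
  also have "\<dots> = density (density (\<mu> \<Otimes>\<^sub>M lborel) (\<lambda>(w, y). 1 * p y)) (\<lambda>x. ennreal (r (F x)))"
    by (rule density_density_eq[symmetric]) simp_all
  also have "density (\<mu> \<Otimes>\<^sub>M lborel) (\<lambda>(w, y). 1 * p y) = \<mu> \<Otimes>\<^sub>M density lborel p"
    by (subst pair_measure_density[symmetric]) (auto simp: density_1 P.sigma_finite_measure_axioms lborel.sigma_finite_measure_axioms)
  finally have joint: "distr (\<mu> \<Otimes>\<^sub>M gaussian_noise \<sigma>) (\<mu> \<Otimes>\<^sub>M borel) (\<lambda>(w, z). (w, f w + z))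
    = density (\<mu> \<Otimes>\<^sub>M density lborel p) (\<lambda>x. ennreal (r (F x)))" .
  have fst: "distr (\<mu> \<Otimes>\<^sub>M gaussian_noise \<sigma>) \<mu> (\<lambda>(w, z). w) = \<mu>"
    using N.distr_pair_fst[of \<mu>] by (simp add: case_prod_beta')
  have "gaussian_channel_mi b \<sigma> \<mu> f = KL_divergence b (\<mu> \<Otimes>\<^sub>M density lborel p)
      (density (\<mu> \<Otimes>\<^sub>M density lborel p) (\<lambda>x. ennreal (r (F x))))"
    unfolding gaussian_channel_mi_def \<mu>N.mutual_information_def joint[symmetric] out fst
    by (simp add: case_prod_beta')
  also have "\<dots> = (\<integral>x. r (F x) * log b (r (F x)) \<partial>(\<mu> \<Otimes>\<^sub>M density lborel p))"
    using \<open>b > 1\<close> by (intro \<mu>P.KL_density) (auto simp: r_def case_prod_beta')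
  also have "\<dots> = (\<integral>x. r x * log b (r x) \<partial>distr (\<mu> \<Otimes>\<^sub>M density lborel p) (borel \<Otimes>\<^sub>M borel) F)"
    by (subst integral_distr) simp_all
  \<comment> \<open>The second factor is written as an image under the identity so that
    \<open>F\<close> acts as a product map.\<close>
  also have "distr (\<mu> \<Otimes>\<^sub>M density lborel p) (borel \<Otimes>\<^sub>M borel) F
      = distr \<mu> borel f \<Otimes>\<^sub>M distr (density lborel p) borel (\<lambda>y. y)"
    unfolding F_def by (rule pair_measure_distr[symmetric])
      (auto intro!: prob_space.prob_space_distr P prob_space_imp_sigma_finite)
  also have "distr (density lborel p) borel (\<lambda>y. y) = density lborel p"
    by (rule distr_id2) simp
  finally show ?thesis .
qed

text \<open>Both sides have the same integral formula, since the identity pushes the law of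
  \<open>f\<close> forward to itself.\<close>

lemma gaussian_channel_mi_distr:
  fixes f :: "'a \<Rightarrow> real"
  assumes "prob_space \<mu>" and f: "f \<in> borel_measurable \<mu>" and "\<sigma> > 0" and "b > 1"
  shows "gaussian_channel_mi b \<sigma> \<mu> f = gaussian_channel_mi b \<sigma> (distr \<mu> borel f) (\<lambda>s. s)"
proof -
  have "prob_space (distr \<mu> borel f)"
    by (intro prob_space.prob_space_distr assms)
  moreover have "distr (distr \<mu> borel f) borel (\<lambda>s. s) = distr \<mu> borel f"
    by (rule distr_id2) simp
  ultimately show ?thesis
    by (simp add: gaussian_channel_mi_eq_integral assms)
qed

section \<open>Support of a law and almost sure containment\<close>

text \<open>The complement of the support is the union of all open null sets. By Lindelof countably
  many of them suffice, so this union is itself null.\<close>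

lemma AE_law_support:
  fixes \<nu> :: "'a::second_countable_topology measure"
  assumes [measurable_cong]: "sets \<nu> = sets borel"
  shows "AE x in \<nu>. x \<in> law_support \<nu>"
proof -
  define F where "F = {U. open U \<and> emeasure \<nu> U = 0}"
  obtain F' where F': "F' \<subseteq> F" "countable F'" "\<Union>F' = \<Union>F"
    using Lindelof[of F] unfolding F_def by blast
  have "AE x in \<nu>. \<forall>U\<in>F'. x \<notin> U"
  proof (subst AE_ball_countable[OF F'(2)], intro ballI)
    fix U assume "U \<in> F'"
    then have "U \<in> null_sets \<nu>"
      using F'(1) by (auto simp: F_def null_sets_def assms)
    then show "AE x in \<nu>. x \<notin> U"
      by (rule AE_not_in)
  qed
  then show ?thesis
  proof eventually_elim
    case (elim x)
    then have "x \<notin> \<Union>F"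
      using F'(3) by blast
    then show ?case
      unfolding law_support_def F_def by (auto simp: zero_less_iff_neq_zero)
  qed
qed

text \<open>If the law lives on a closed set, the complement is an open null set and hence misses
  the support. This turns the support condition on \<open>S\<close> into almost sure bounds.\<close>

lemma law_support_subset_iff:
  fixes \<nu> :: "'a::second_countable_topology measure"
  assumes [measurable_cong]: "sets \<nu> = sets borel" and "closed C"
  shows "law_support \<nu> \<subseteq> C \<longleftrightarrow> (AE x in \<nu>. x \<in> C)"
proof
  assume "law_support \<nu> \<subseteq> C"
  then show "AE x in \<nu>. x \<in> C"
    using AE_law_support[OF assms(1)] by auto
next
  assume ae: "AE x in \<nu>. x \<in> C"
  have "- C \<in> sets \<nu>"
    using assms by auto
  then have "emeasure \<nu> (- C) = 0"
    using ae sets_eq_imp_space_eq[OF assms(1)] by (subst (asm) AE_iff_measurable[of "- C"]) auto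
  moreover have "open (- C)"
    using \<open>closed C\<close> by (simp add: open_Compl)
  ultimately show "law_support \<nu> \<subseteq> C"
    unfolding law_support_def by fastforce
qed

section \<open>Splitting a bounded random variable into weighted inputs\<close>

lemma Hsum_0 [simp]: "Hsum h 0 = 0"
  by (simp add: Hsum_def)

lemma Hsum_Suc [simp]: "Hsum h (Suc n) = Hsum h n + h (Suc n)"
  by (simp add: Hsum_def)

lemma Hsum_diff:
  assumes "k \<le> n"
  shows "Hsum h n - Hsum h k = (\<Sum>i = Suc k..n. h i)"
  using assms by (induction n rule: dec_induct) auto

lemma Hsum_mono:
  assumes "\<And>i. i \<in> {1..n} \<Longrightarrow> h i > 0" and "k \<le> n"
  shows "Hsum h k \<le> Hsum h n"
  unfolding Hsum_def using assms by (intro sum_mono2) (auto simp: less_imp_le)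

lemma (in prob_space) integrable_excess:
  fixes S :: "'a \<Rightarrow> real"
  assumes [measurable]: "S \<in> borel_measurable M" and "AE x in M. 0 \<le> S x \<and> S x \<le> B"
  shows "integrable M (\<lambda>x. max (S x - c) 0)"
proof (rule integrable_const_bound[where B = "\<bar>B\<bar> + \<bar>c\<bar>"])
  show "AE x in M. norm (max (S x - c) 0) \<le> \<bar>B\<bar> + \<bar>c\<bar>"
    using assms(2) by eventually_elim auto
qed simp

text \<open>For each outcome the excess is 1-Lipschitz in the level \<open>c\<close>, and
  expectation preserves this. The continuity feeds the intermediate value theorem in the
  splitting.\<close>

lemma (in prob_space) continuous_on_expected_excess:
  fixes S :: "'a \<Rightarrow> real"
  assumes "S \<in> borel_measurable M" and "AE x in M. 0 \<le> S x \<and> S x \<le> B"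
  shows "continuous_on A (\<lambda>c. expectation (\<lambda>x. max (S x - c) 0))"
proof -
  note int = integrable_excess[OF assms]
  have "dist (expectation (\<lambda>x. max (S x - c) 0)) (expectation (\<lambda>x. max (S x - d) 0)) \<le> dist c d" for c d
  proof -
    have "dist (expectation (\<lambda>x. max (S x - c) 0)) (expectation (\<lambda>x. max (S x - d) 0))
      = \<bar>expectation (\<lambda>x. max (S x - c) 0 - max (S x - d) 0)\<bar>"
      by (simp add: int dist_real_def)
    also have "\<dots> \<le> expectation (\<lambda>x. \<bar>max (S x - c) 0 - max (S x - d) 0\<bar>)"
      by (rule integral_abs_bound)
    also have "\<dots> \<le> expectation (\<lambda>x. dist c d)"
      by (rule integral_mono) (auto simp: int dist_real_def)
    finally show ?thesis
      by (simp add: prob_space)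
  qed
  then have "1-lipschitz_on A (\<lambda>c. expectation (\<lambda>x. max (S x - c) 0))"
    by (intro lipschitz_onI) simp_all
  then show ?thesis
    by (rule lipschitz_on_continuous_on)
qed

text \<open>The form is chosen for induction on \<open>n\<close>: the upper end is
  \<open>Hsum h n\<close> instead of 1, the bounds are unnormalised sums instead of multiples of
  \<open>alpha_bar\<close>, and all inputs live on the probability space of
  \<open>S\<close>.\<close>

lemma (in prob_space) splitting_exists:
  fixes h \<alpha> :: "nat \<Rightarrow> real" and S :: "'a \<Rightarrow> real"
  assumes "S \<in> borel_measurable M"
    and "\<And>k. k \<in> {1..n} \<Longrightarrow> h k > 0"
    and "\<And>i j. 1 \<le> i \<Longrightarrow> i \<le> j \<Longrightarrow> j \<le> n \<Longrightarrow> \<alpha> j \<le> \<alpha> i"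
    and "AE x in M. 0 \<le> S x \<and> S x \<le> Hsum h n"
    and "\<And>k. k < n \<Longrightarrow> expectation (\<lambda>x. max (S x - Hsum h k) 0) \<le> (\<Sum>i = Suc k..n. h i * \<alpha> i)"
  shows "\<exists>X. (\<forall>k\<in>{1..n}. X k \<in> borel_measurable M \<and> (AE x in M. 0 \<le> X k x \<and> X k x \<le> 1) \<and>
      expectation (X k) \<le> \<alpha> k) \<and> (AE x in M. (\<Sum>k = 1..n. h k * X k x) = S x)"
  using assms
proof (induction n arbitrary: S)
  case 0
  then have "AE x in M. S x = 0"
    by auto
  then show ?case
    by auto
next
  case (Suc n)
  note [measurable] = Suc.prems(1)
  note bnd = Suc.prems(4)
  define \<eta> a where "\<eta> = h (Suc n)" and "a = \<alpha> (Suc n)"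
  define u where "u c = expectation (\<lambda>x. max (S x - c) 0)" for c
  have "\<eta> > 0"
    using Suc.prems(2) by (simp add: \<eta>_def)
  have H: "Hsum h (Suc n) = Hsum h n + \<eta>"
    by (simp add: \<eta>_def)
  have Hnn: "0 \<le> Hsum h k" if "k \<le> n" for k
    using Hsum_mono[of k h 0] Suc.prems(2) that by auto
  have Hle: "Hsum h k \<le> Hsum h n" if "k \<le> n" for k
    using Hsum_mono[of n h k] Suc.prems(2) that by auto
  note int = integrable_excess[OF Suc.prems(1) bnd]
  have u_le: "u (Hsum h k) \<le> (\<Sum>i = Suc k..n. h i * \<alpha> i) + \<eta> * a" if "k \<le> n" for k
    using Suc.prems(5)[of k] that by (simp add: u_def \<eta>_def a_def)
  have "AE x in M. max (S x - (Hsum h n + \<eta>)) 0 = 0"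
    using bnd H by auto
  then have u_end: "u (Hsum h n + \<eta>) = 0"
    unfolding u_def by (subst integral_cong_AE[where g = "\<lambda>_. 0"]) auto

  \<comment> \<open>\<open>v c\<close> is the mean of the slice of \<open>S\<close> between the
    levels \<open>c\<close> and \<open>c + \<eta>\<close>.\<close>
  define v where "v c = u c - u (c + \<eta>)" for c
  have cont: "continuous_on {0..Hsum h n} v"
  proof -
    have u: "continuous_on A u" for A
      using continuous_on_expected_excess[OF Suc.prems(1) bnd] by (simp add: u_def[abs_def])
    have "continuous_on {0..Hsum h n} (\<lambda>c. u (c + \<eta>))"
      by (rule continuous_on_compose2[OF u[of UNIV]]) (auto intro: continuous_on_add continuous_on_id continuous_on_const)
    then show ?thesis
      unfolding v_def[abs_def] by (intro continuous_on_diff u)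
  qed
  \<comment> \<open>At the top level the constraint with \<open>k = n\<close> bounds the slice mean
    by \<open>\<eta> * a\<close>. So either level 0 already satisfies this bound, or
    \<open>v\<close> attains \<open>\<eta> * a\<close> in between.\<close>
  have "v (Hsum h n) \<le> \<eta> * a"
    using u_le[of n] u_end by (simp add: v_def)
  then obtain c where c: "0 \<le> c" "c \<le> Hsum h n" "v c \<le> \<eta> * a" "c = 0 \<or> v c = \<eta> * a"
    using IVT2'[of v "Hsum h n" "\<eta> * a" 0] cont Hnn[of n] by (cases "v 0 \<le> \<eta> * a") auto

  define g where "g x = max (S x - c) 0 - max (S x - (c + \<eta>)) 0" for x
  \<comment> \<open>\<open>S'\<close> agrees with \<open>S\<close> below \<open>c\<close>, is
    constantly \<open>c\<close> while \<open>S\<close> runs through the slice, and equals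
    \<open>S - \<eta>\<close> above it.\<close>
  define S' where "S' x = S x - g x" for x
  have [measurable]: "g \<in> borel_measurable M" "S' \<in> borel_measurable M"
    unfolding g_def[abs_def] S'_def[abs_def] by measurable
  have g: "0 \<le> g x" "g x \<le> \<eta>" for x
    using \<open>\<eta> > 0\<close> by (auto simp: g_def)
  have Eg: "expectation g = v c"
    by (simp add: g_def[abs_def] v_def u_def int)

  have "\<exists>X. (\<forall>k\<in>{1..n}. X k \<in> borel_measurable M \<and> (AE x in M. 0 \<le> X k x \<and> X k x \<le> 1) \<and>
      expectation (X k) \<le> \<alpha> k) \<and> (AE x in M. (\<Sum>k = 1..n. h k * X k x) = S' x)"
  proof (rule Suc.IH)
    show "AE x in M. 0 \<le> S' x \<and> S' x \<le> Hsum h n"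
      using bnd by eventually_elim (use c \<open>\<eta> > 0\<close> H in \<open>auto simp: S'_def g_def max_def\<close>)
    fix k assume "k < n"
    show "expectation (\<lambda>x. max (S' x - Hsum h k) 0) \<le> (\<Sum>i = Suc k..n. h i * \<alpha> i)"
    proof (cases "c \<le> Hsum h k")
      case True
      \<comment> \<open>The total weight of the inputs after the \<open>k\<close>-th one, including
        the last. The estimate is multiplied by \<open>D\<close> to avoid fractions.\<close>
      define D where "D = Hsum h n + \<eta> - Hsum h k"
      have "D > 0" "\<eta> \<le> D"
        using Hle[of k] \<open>k < n\<close> \<open>\<eta> > 0\<close> by (auto simp: D_def)
      have "D = (\<Sum>i = Suc k..Suc n. h i)"
        using Hsum_diff[of k "Suc n" h] \<open>k < n\<close> by (simp add: D_def \<eta>_def)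
      then have "a * D = (\<Sum>i = Suc k..Suc n. h i * \<alpha> (Suc n))"
        by (simp only: a_def sum_distrib_left mult.commute[of "\<alpha> (Suc n)"])
      \<comment> \<open>\<open>a\<close> is the smallest of the mean constraints, hence at most
        their weighted average over the remaining inputs.\<close>
      also have "\<dots> \<le> (\<Sum>i = Suc k..Suc n. h i * \<alpha> i)"
        using Suc.prems(2,3) by (intro sum_mono mult_left_mono) (auto simp: less_imp_le)
      finally have aD: "\<eta> * (a * D) \<le> \<eta> * ((\<Sum>i = Suc k..n. h i * \<alpha> i) + \<eta> * a)"
        using \<open>k < n\<close> \<open>\<eta> > 0\<close> by (simp add: \<eta>_def a_def)
      \<comment> \<open>\<open>S'\<close> exceeds a level at or above \<open>c\<close> only where
        the whole slice has been removed, so its excess is that of \<open>S\<close> at a level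
        higher by \<open>\<eta>\<close>.\<close>
      have "D * expectation (\<lambda>x. max (S' x - Hsum h k) 0) = expectation (\<lambda>x. D * max (S x - (Hsum h k + \<eta>)) 0)"
        using True \<open>\<eta> > 0\<close>
        by (subst integral_mult_right_zero[symmetric], intro Bochner_Integration.integral_cong)
          (auto simp: S'_def g_def max_def)
      also have "\<dots> \<le> expectation (\<lambda>x. (D - \<eta>) * max (S x - Hsum h k) 0)"
      proof (intro integral_mono_AE integrable_mult_right int)
        \<comment> \<open>convexity of the excess function between Hsum h k and Hsum h (Suc n), where it vanishes\<close>
        show "AE x in M. D * max (S x - (Hsum h k + \<eta>)) 0 \<le> (D - \<eta>) * max (S x - Hsum h k) 0"
          using bnd
        proof eventually_elim
          case (elim x)
          then have "\<eta> * (S x - Hsum h k) \<le> \<eta> * D"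
            using \<open>\<eta> > 0\<close> H by (intro mult_left_mono) (auto simp: D_def)
          moreover have "0 \<le> (D - \<eta>) * max (S x - Hsum h k) 0"
            using \<open>\<eta> \<le> D\<close> by simp
          ultimately show ?case
            using \<open>\<eta> > 0\<close> by (auto simp: max_def algebra_simps)
        qed
      qed
      also have "\<dots> = (D - \<eta>) * u (Hsum h k)"
        by (simp add: u_def)
      also have "\<dots> \<le> (D - \<eta>) * ((\<Sum>i = Suc k..n. h i * \<alpha> i) + \<eta> * a)"
        using \<open>\<eta> \<le> D\<close> \<open>k < n\<close> by (intro mult_left_mono u_le) auto
      \<comment> \<open>Writing \<open>T\<close> for the sum,
        \<open>(D - \<eta>) * (T + \<eta> * a)\<close> equals \<open>D * T\<close> plus
        \<open>\<eta> * (a * D) - \<eta> * (T + \<eta> * a)\<close>, and this difference is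
        nonpositive by \<open>aD\<close>.\<close>
      also have "\<dots> \<le> D * (\<Sum>i = Suc k..n. h i * \<alpha> i)"
        using aD by (simp add: algebra_simps)
      finally show ?thesis
        using \<open>D > 0\<close> by simp
    next
      case False
      \<comment> \<open>Here \<open>c\<close> exceeds a nonnegative level, which rules out
        \<open>c = 0\<close>.\<close>
      then have "v c = \<eta> * a"
        using c Hnn[of k] \<open>k < n\<close> by auto
      \<comment> \<open>Where \<open>g\<close> is nonzero, both \<open>S\<close> and
        \<open>S'\<close> are at least \<open>c\<close>, above the level, so the removed slice is
        subtracted in full from the excess.\<close>
      have "expectation (\<lambda>x. max (S' x - Hsum h k) 0)
          = expectation (\<lambda>x. max (S x - Hsum h k) 0 - g x)"
        using False \<open>\<eta> > 0\<close>
        by (intro Bochner_Integration.integral_cong) (auto simp: S'_def g_def max_def)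
      also have "\<dots> = u (Hsum h k) - v c"
        by (simp add: g_def v_def u_def int)
      finally show ?thesis
        using u_le[of k] \<open>k < n\<close> \<open>v c = \<eta> * a\<close> by simp
    qed
  qed (use Suc.prems(2,3) in auto)
  then obtain X where X: "\<And>k. k \<in> {1..n} \<Longrightarrow> X k \<in> borel_measurable M"
      "\<And>k. k \<in> {1..n} \<Longrightarrow> AE x in M. 0 \<le> X k x \<and> X k x \<le> 1"
      "\<And>k. k \<in> {1..n} \<Longrightarrow> expectation (X k) \<le> \<alpha> k"
      "AE x in M. (\<Sum>k = 1..n. h k * X k x) = S' x"
    by blast
  \<comment> \<open>The slice has height at most \<open>\<eta>\<close>, so dividing by this weight
    gives an input in the unit interval.\<close>
  define X' where "X' = X(Suc n := \<lambda>x. g x / \<eta>)"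
  have "X' k \<in> borel_measurable M \<and> (AE x in M. 0 \<le> X' k x \<and> X' k x \<le> 1) \<and> expectation (X' k) \<le> \<alpha> k"
    if "k \<in> {1..Suc n}" for k
  proof (cases "k = Suc n")
    case True
    then show ?thesis
      using g \<open>\<eta> > 0\<close> c(3) by (auto simp: X'_def Eg a_def field_simps)
  next
    case False
    then show ?thesis
      using X(1-3)[of k] that by (auto simp: X'_def)
  qed
  moreover have "AE x in M. (\<Sum>k = 1..Suc n. h k * X' k x) = S x"
    using X(4)
  proof eventually_elim
    case (elim x)
    have "(\<Sum>k = 1..n. h k * X' k x) = (\<Sum>k = 1..n. h k * X k x)"
      by (intro sum.cong) (auto simp: X'_def)
    then show ?case
      using elim \<open>\<eta> > 0\<close> by (simp add: X'_def S'_def \<eta>_def[symmetric])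
  qed
  ultimately show ?case
    by blast
qed

section \<open>Correspondence between input laws and sum laws\<close>

text \<open>For \<open>k < n\<close> the remaining weight is positive, so the division in
  \<open>alpha_bar\<close> cancels.\<close>

lemma excess_bound_eq:
  fixes h \<alpha> :: "nat \<Rightarrow> real"
  assumes "\<And>k. k \<in> {1..n} \<Longrightarrow> h k > 0" and "(\<Sum>k = 1..n. h k) = 1" and "k < n"
  shows "(1 - Hsum h k) * alpha_bar n h \<alpha> k = (\<Sum>i = Suc k..n. h i * \<alpha> i)"
proof -
  have "1 - Hsum h k = (\<Sum>i = Suc k..n. h i)"
    using Hsum_diff[of k n h] assms by (simp add: Hsum_def)
  also have "\<dots> > 0"
    using assms by (intro sum_pos) auto
  finally show ?thesis
    by (simp add: alpha_bar_def)
qed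

text \<open>The first \<open>k\<close> inputs contribute at most their total weight
  \<open>Hsum h k\<close>, and the others contribute a nonnegative amount.\<close>

lemma excess_weighted_sum_le:
  fixes h x :: "nat \<Rightarrow> real"
  assumes "\<And>i. i \<in> {1..n} \<Longrightarrow> h i > 0" and "\<And>i. i \<in> {1..n} \<Longrightarrow> 0 \<le> x i \<and> x i \<le> 1" and "k \<le> n"
  shows "max ((\<Sum>i = 1..n. h i * x i) - Hsum h k) 0 \<le> (\<Sum>i = Suc k..n. h i * x i)"
proof -
  have "(\<Sum>i = 1..n. h i * x i) = (\<Sum>i = 1..k. h i * x i) + (\<Sum>i = Suc k..n. h i * x i)"
    using sum.ub_add_nat[of 1 k "\<lambda>i. h i * x i" "n - k"] \<open>k \<le> n\<close> by simp
  moreover have "(\<Sum>i = 1..k. h i * x i) \<le> Hsum h k"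
    unfolding Hsum_def using assms by (intro sum_mono) (auto simp: mult_left_le less_imp_le)
  moreover have "0 \<le> (\<Sum>i = Suc k..n. h i * x i)"
    using assms by (intro sum_nonneg) (auto simp: less_imp_le)
  ultimately show ?thesis
    by simp
qed

lemma distr_weighted_sum_admissible:
  fixes h \<alpha> :: "nat \<Rightarrow> real"
  assumes "\<And>k. k \<in> {1..n} \<Longrightarrow> h k > 0" and "(\<Sum>k = 1..n. h k) = 1" and "n \<ge> 1"
    and \<mu>: "\<mu> \<in> admissible_input_laws n \<alpha>"
  shows "distr \<mu> borel (\<lambda>x. \<Sum>k = 1..n. h k * x k) \<in> admissible_sum_laws n h \<alpha>"
proof -
  let ?S = "\<lambda>x. \<Sum>k = 1..n. h k * x k"
  interpret prob_space \<mu>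
    using \<mu> by (simp add: admissible_input_laws_def)
  have [measurable_cong]: "sets \<mu> = sets (\<Pi>\<^sub>M k\<in>{1..n}. (borel :: real measure))"
    and ae: "\<And>k. k \<in> {1..n} \<Longrightarrow> AE x in \<mu>. 0 \<le> x k \<and> x k \<le> 1"
    and le: "\<And>k. k \<in> {1..n} \<Longrightarrow> expectation (\<lambda>x. x k) \<le> \<alpha> k"
    using \<mu> by (auto simp: admissible_input_laws_def)
  have [measurable]: "(\<lambda>x. x k) \<in> borel_measurable \<mu>" if "k \<in> {1..n}" for k
    using that by measurable
  have S[measurable]: "?S \<in> borel_measurable \<mu>"
    by measurable
  have ae_all: "AE x in \<mu>. \<forall>k\<in>{1..n}. 0 \<le> x k \<and> x k \<le> 1"
    using ae by (subst AE_ball_countable) auto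
  have S01: "AE x in \<mu>. 0 \<le> ?S x \<and> ?S x \<le> 1"
    using ae_all
  proof eventually_elim
    case (elim x)
    have "?S x \<le> (\<Sum>k = 1..n. h k)"
      using elim assms(1) by (intro sum_mono) (auto simp: mult_left_le less_imp_le)
    moreover have "0 \<le> ?S x"
      using elim assms(1) by (intro sum_nonneg) (auto simp: less_imp_le)
    ultimately show ?case
      using assms(2) by simp
  qed
  have int: "integrable \<mu> (\<lambda>x. x k)" if "k \<in> {1..n}" for k
    by (rule integrable_const_bound[where B = 1]) (use ae[OF that] that in auto)
  have "expectation (\<lambda>x. max (?S x - Hsum h k) 0) \<le> (1 - Hsum h k) * alpha_bar n h \<alpha> k"
    if "k \<le> n - 1" for k
  proof -
    have "expectation (\<lambda>x. max (?S x - Hsum h k) 0) \<le> expectation (\<lambda>x. \<Sum>i = Suc k..n. h i * x i)"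
    proof (rule integral_mono_AE)
      show "integrable \<mu> (\<lambda>x. max (?S x - Hsum h k) 0)"
        by (rule integrable_excess[OF S S01])
      show "integrable \<mu> (\<lambda>x. \<Sum>i = Suc k..n. h i * x i)"
        using int by (intro Bochner_Integration.integrable_sum integrable_mult_right) auto
      show "AE x in \<mu>. max (?S x - Hsum h k) 0 \<le> (\<Sum>i = Suc k..n. h i * x i)"
        using ae_all by eventually_elim (use assms(1) that in \<open>intro excess_weighted_sum_le; auto\<close>)
    qed
    also have "\<dots> = (\<Sum>i = Suc k..n. h i * expectation (\<lambda>x. x i))"
      using int by (subst Bochner_Integration.integral_sum) auto
    also have "\<dots> \<le> (\<Sum>i = Suc k..n. h i * \<alpha> i)"
      using assms(1) le by (intro sum_mono mult_left_mono) (auto simp: less_imp_le)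
    also have "\<dots> = (1 - Hsum h k) * alpha_bar n h \<alpha> k"
      using that \<open>n \<ge> 1\<close> by (intro excess_bound_eq[symmetric] assms) auto
    finally show ?thesis .
  qed
  then show ?thesis
    using S01 prob_space_distr[OF S]
    by (auto simp: admissible_sum_laws_def law_support_subset_iff AE_distr_iff integral_distr)
qed

text \<open>The probability space is \<open>\<nu>\<close> itself and the variable to be split is the
  identity. The law of the resulting vector of inputs is the required \<open>\<mu>\<close>.\<close>

lemma admissible_sum_law_realized:
  fixes h \<alpha> :: "nat \<Rightarrow> real"
  assumes "\<And>k. k \<in> {1..n} \<Longrightarrow> h k > 0" and "(\<Sum>k = 1..n. h k) = 1"
    and "\<And>i j. 1 \<le> i \<Longrightarrow> i \<le> j \<Longrightarrow> j \<le> n \<Longrightarrow> \<alpha> j \<le> \<alpha> i"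
    and \<nu>: "\<nu> \<in> admissible_sum_laws n h \<alpha>"
  obtains \<mu> where "\<mu> \<in> admissible_input_laws n \<alpha>"
    and "distr \<mu> borel (\<lambda>x. \<Sum>k = 1..n. h k * x k) = \<nu>"
proof -
  interpret prob_space \<nu>
    using \<nu> by (simp add: admissible_sum_laws_def)
  have sets[measurable_cong]: "sets \<nu> = sets borel"
    using \<nu> by (simp add: admissible_sum_laws_def)
  have "AE s in \<nu>. s \<in> {0..1}"
    using \<nu> by (subst law_support_subset_iff[symmetric]) (auto simp: admissible_sum_laws_def)
  then have "AE s in \<nu>. 0 \<le> s \<and> s \<le> Hsum h n"
    using assms(2) by (simp add: Hsum_def)
  moreover have "expectation (\<lambda>s. max (s - Hsum h k) 0) \<le> (\<Sum>i = Suc k..n. h i * \<alpha> i)" if "k < n" for k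
  proof -
    have "k \<in> {0..n - 1}"
      using that by auto
    then have "expectation (\<lambda>s. max (s - Hsum h k) 0) \<le> (1 - Hsum h k) * alpha_bar n h \<alpha> k"
      using \<nu> unfolding admissible_sum_laws_def by blast
    then show ?thesis
      by (simp only: excess_bound_eq[OF assms(1,2) that])
  qed
  ultimately have "\<exists>X. (\<forall>k\<in>{1..n}. X k \<in> borel_measurable \<nu> \<and>
      (AE s in \<nu>. 0 \<le> X k s \<and> X k s \<le> 1) \<and> expectation (X k) \<le> \<alpha> k) \<and>
      (AE s in \<nu>. (\<Sum>k = 1..n. h k * X k s) = s)"
    using assms(1,3) by (intro splitting_exists) simp_all
  then obtain X where X: "\<And>k. k \<in> {1..n} \<Longrightarrow> X k \<in> borel_measurable \<nu>"
      "\<And>k. k \<in> {1..n} \<Longrightarrow> AE s in \<nu>. 0 \<le> X k s \<and> X k s \<le> 1"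
      "\<And>k. k \<in> {1..n} \<Longrightarrow> expectation (X k) \<le> \<alpha> k"
      "AE s in \<nu>. (\<Sum>k = 1..n. h k * X k s) = s"
    by blast
  \<comment> \<open>The restriction to \<open>{1..n}\<close> places the vector in the space of the
    product measure, whose elements are extensional functions.\<close>
  define V where "V s = (\<lambda>k\<in>{1..n}. X k s)" for s
  have V[measurable]: "V \<in> measurable \<nu> (\<Pi>\<^sub>M k\<in>{1..n}. borel)"
    unfolding V_def[abs_def] using X(1) by (intro measurable_restrict) auto
  let ?\<mu> = "distr \<nu> (\<Pi>\<^sub>M k\<in>{1..n}. borel) V"
  show thesis
  proof
    have "(AE x in ?\<mu>. 0 \<le> x k \<and> x k \<le> 1) \<and> (\<integral>x. x k \<partial>?\<mu>) \<le> \<alpha> k" if k: "k \<in> {1..n}" for k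
    proof -
      have [measurable]: "(\<lambda>x. x k) \<in> borel_measurable (\<Pi>\<^sub>M k\<in>{1..n}. borel)"
        using k by (rule measurable_component_singleton)
      have "(\<integral>x. x k \<partial>?\<mu>) = expectation (X k)"
        using k by (subst integral_distr[OF V]) (simp_all add: V_def)
      moreover have "AE x in ?\<mu>. 0 \<le> x k \<and> x k \<le> 1"
        using X(2)[OF k] k by (subst AE_distr_iff[OF V]) (simp_all add: V_def)
      ultimately show ?thesis
        using X(3)[OF k] by simp
    qed
    then show "?\<mu> \<in> admissible_input_laws n \<alpha>"
      unfolding admissible_input_laws_def using prob_space_distr[OF V] by (intro CollectI conjI ballI) simp_all
    have "distr ?\<mu> borel (\<lambda>x. \<Sum>k = 1..n. h k * x k) = distr \<nu> borel (\<lambda>s. \<Sum>k = 1..n. h k * V s k)"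
      by (subst distr_distr[OF _ V]) (simp_all add: comp_def)
    also have "\<dots> = distr \<nu> borel (\<lambda>s. s)"
    proof (rule distr_cong_AE)
      show "AE s in \<nu>. (\<Sum>k = 1..n. h k * V s k) = s"
        using X(4) by (simp add: V_def)
    qed simp_all
    also have "\<dots> = \<nu>"
      by (rule distr_id2) (simp add: sets)
    finally show "distr ?\<mu> borel (\<lambda>x. \<Sum>k = 1..n. h k * x k) = \<nu>" .
  qed
qed

theorem corollary3:
  fixes n :: nat and h \<alpha> :: "nat \<Rightarrow> real" and \<sigma> b :: real
  assumes "n \<ge> 2"
    and "\<And>k. k \<in> {1..n} \<Longrightarrow> h k > 0"
    and "(\<Sum>k = 1..n. h k) = 1"
    and "\<alpha> 1 \<le> 1"
    and "\<And>i j. 1 \<le> i \<Longrightarrow> i < j \<Longrightarrow> j \<le> n \<Longrightarrow> \<alpha> i > \<alpha> j"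
    and "\<alpha> n > 0"
    and "\<alpha> n \<le> 1 / 2"
    and "\<sigma> > 0"
    and "b > 1"
  shows "BC_OIC_capacity b n h \<alpha> \<sigma> =
    (SUP \<nu> \<in> admissible_sum_laws n h \<alpha>. ereal (gaussian_channel_mi b \<sigma> \<nu> (\<lambda>s. s)))"
proof -
  let ?S = "\<lambda>x. \<Sum>k = 1..n. h k * x k"
  have mi: "gaussian_channel_mi b \<sigma> \<mu> ?S = gaussian_channel_mi b \<sigma> (distr \<mu> borel ?S) (\<lambda>s. s)"
    if "\<mu> \<in> admissible_input_laws n \<alpha>" for \<mu>
  proof (rule gaussian_channel_mi_distr)
    show "prob_space \<mu>"
      using that by (simp add: admissible_input_laws_def)
    have [measurable_cong]: "sets \<mu> = sets (\<Pi>\<^sub>M k\<in>{1..n}. (borel :: real measure))"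
      using that by (simp add: admissible_input_laws_def)
    show "?S \<in> borel_measurable \<mu>"
      by measurable
  qed fact+
  have mono: "\<alpha> j \<le> \<alpha> i" if "1 \<le> i" "i \<le> j" "j \<le> n" for i j
    using assms(5)[of i j] that by (cases "i = j") auto
  show ?thesis
    unfolding BC_OIC_capacity_def
  \<comment> \<open>Each law on one side is matched with a law on the other having the same mutual
    information, so the suprema agree whether or not they are attained.\<close>
  proof (rule SUP_eq)
    fix \<mu> assume \<mu>: "\<mu> \<in> admissible_input_laws n \<alpha>"
    have "distr \<mu> borel ?S \<in> admissible_sum_laws n h \<alpha>"
      using \<open>n \<ge> 2\<close> by (intro distr_weighted_sum_admissible assms \<mu>) simp_all
    then show "\<exists>\<nu>\<in>admissible_sum_laws n h \<alpha>. ereal (gaussian_channel_mi b \<sigma> \<mu> ?S)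
        \<le> ereal (gaussian_channel_mi b \<sigma> \<nu> (\<lambda>s. s))"
      using mi[OF \<mu>] by auto
  next
    fix \<nu> assume "\<nu> \<in> admissible_sum_laws n h \<alpha>"
    then obtain \<mu> where "\<mu> \<in> admissible_input_laws n \<alpha>" "distr \<mu> borel ?S = \<nu>"
      using admissible_sum_law_realized[of n h \<alpha> \<nu>] assms(2,3) mono by blast
    then show "\<exists>\<mu>\<in>admissible_input_laws n \<alpha>. ereal (gaussian_channel_mi b \<sigma> \<nu> (\<lambda>s. s))
        \<le> ereal (gaussian_channel_mi b \<sigma> \<mu> ?S)"
      using mi by (intro bexI[of _ \<mu>]) auto
  qed
qed

end
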